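(* Let $(X,\tau)$ be a topological space. The following are equivalent: (1) $X$ is extremally disconnected. (2) $\tau = \mathcal{AB}(X)$. (3) Every $\mathcal{AB}$-set in $X$ is open.
   Context: For a subset $A$ of a topological space $X$, $\mathrm{Int}\,A$ denotes the interior and $\overline{A}$ the closure of $A$ in $X$. $A$ is semi-open if $A \subseteq \overline{\mathrm{Int}\,A}$; semi-closed if its complement is semi-open; semi-regular if it is both semi-open and semi-closed. $A$ is an $\mathcal{AB}$-set if $A = U \cap V$ with $U$ open and $V$ semi-regular; $\mathcal{AB}(X)$ is the collection of all $\mathcal{AB}$-sets in $X$. A space $X$ is extremally disconnected if every open subset of $X$ has open closure (no separation axioms are assumed). *)

theory Defs
  imports "HOL-Analysis.Abstract_Topology"
begin

(* Since X closure_of S is contained in topspace X, this entails A \<subseteq> topspace X. *)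
definition semi_openin :: "'a topology \<Rightarrow> 'a set \<Rightarrow> bool"
  where "semi_openin X A \<longleftrightarrow> A \<subseteq> X closure_of (X interior_of A)"

definition semi_closedin :: "'a topology \<Rightarrow> 'a set \<Rightarrow> bool"
  where "semi_closedin X A \<longleftrightarrow> A \<subseteq> topspace X \<and> semi_openin X (topspace X - A)"

definition semi_regularin :: "'a topology \<Rightarrow> 'a set \<Rightarrow> bool"
  where "semi_regularin X A \<longleftrightarrow> semi_openin X A \<and> semi_closedin X A"

definition AB_sets :: "'a topology \<Rightarrow> 'a set set"
  where "AB_sets X = {A. \<exists>U V. openin X U \<and> semi_regularin X V \<and> A = U \<inter> V}"

definition extremally_disconnected_space :: "'a topology \<Rightarrow> bool"
  where "extremally_disconnected_space X \<longleftrightarrow> (\<forall>U. openin X U \<longrightarrow> openin X (X closure_of U))"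

end

theory Submission
  imports Defs
begin

text \<open>
  In an extremally disconnected space a semi-regular set \<open>V\<close> equals the closure of its interior:
  that closure is open and disjoint from the interior of the complement of \<open>V\<close>, hence from the
  closure of the latter, which contains the complement of \<open>V\<close>. Conversely, the closure of an open
  set is semi-regular, hence an \<open>\<A>\<B>\<close>-set.
\<close>

lemma openin_imp_semi_openin:
  assumes "openin X U" shows "semi_openin X U"
  using assms by (simp add: semi_openin_def interior_of_openin closure_of_subset openin_subset)

text \<open>\<open>U\<close> lies in the interior of its closure, so taking closures gives
  semi-openness; the complement of the closure is open, hence semi-open.\<close>

lemma semi_regularin_closure_of:
  assumes "openin X U" shows "semi_regularin X (X closure_of U)"
proof -
  have "U \<subseteq> X interior_of (X closure_of U)"
    using assms by (simp add: interior_of_maximal closure_of_subset openin_subset)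
  then have "semi_openin X (X closure_of U)"
    by (simp add: semi_openin_def closure_of_mono)
  moreover have "semi_closedin X (X closure_of U)"
    by (simp add: semi_closedin_def closure_of_subset_topspace openin_imp_semi_openin openin_diff)
  ultimately show ?thesis
    by (simp add: semi_regularin_def)
qed

lemma semi_regularin_topspace: "semi_regularin X (topspace X)"
  using semi_regularin_closure_of[OF openin_topspace] by simp

lemma openin_imp_AB_sets:
  assumes "openin X U" shows "U \<in> AB_sets X"
proof -
  have "U = U \<inter> topspace X"
    using openin_subset[OF assms] by blast
  then show ?thesis
    using assms semi_regularin_topspace unfolding AB_sets_def by blast
qed

lemma semi_regularin_imp_AB_sets:
  assumes "semi_regularin X V" shows "V \<in> AB_sets X"
proof -
  have "V = topspace X \<inter> V"
    using assms by (auto simp: semi_regularin_def semi_closedin_def)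
  then show ?thesis
    using assms openin_topspace unfolding AB_sets_def by blast
qed

lemma extremally_disconnected_semi_regularin_imp_openin:
  assumes "extremally_disconnected_space X" and "semi_regularin X V"
  shows "openin X V"
proof -
  define W where "W = X closure_of (X interior_of V)"
  define N where "N = X interior_of (topspace X - V)"
  have W: "openin X W"
    using assms(1) by (simp add: W_def extremally_disconnected_space_def)
  \<comment> \<open>The first inclusion is semi-openness of \<open>V\<close>, the second its
    semi-closedness.\<close>
  have VW: "V \<subseteq> W" and VN: "topspace X - V \<subseteq> X closure_of N"
    using assms(2)
    by (auto simp: semi_regularin_def semi_closedin_def semi_openin_def W_def N_def)
  have "N \<inter> X interior_of V = {}"
    using interior_of_subset[of X V] interior_of_subset[of X "topspace X - V"]
    unfolding N_def by blast
  then have "N \<inter> W = {}"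
    by (simp add: W_def N_def openin_Int_closure_of_eq_empty)
  \<comment> \<open>Extremal disconnectedness enters here: only because \<open>W\<close> is open
    does its disjointness from \<open>N\<close> pass to the closure of \<open>N\<close>.\<close>
  then have "W \<inter> X closure_of N = {}"
    using W by (simp add: openin_Int_closure_of_eq_empty Int_commute)
  then have "W \<subseteq> V"
    using VN openin_subset[OF W] by blast
  then show ?thesis
    using VW W by (simp add: subset_antisym)
qed

lemma extremally_disconnected_space_iff_AB_sets_openin:
  "extremally_disconnected_space X \<longleftrightarrow> (\<forall>A\<in>AB_sets X. openin X A)"
proof
  assume "extremally_disconnected_space X"
  then show "\<forall>A\<in>AB_sets X. openin X A"
    by (auto simp: AB_sets_def extremally_disconnected_semi_regularin_imp_openin)
next
  assume "\<forall>A\<in>AB_sets X. openin X A"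
  then show "extremally_disconnected_space X"
    by (simp add: extremally_disconnected_space_def semi_regularin_imp_AB_sets
        semi_regularin_closure_of)
qed

theorem theorem3p1:
  fixes X :: "'a topology"
  shows "(extremally_disconnected_space X \<longleftrightarrow> {U. openin X U} = AB_sets X) \<and>
         ({U. openin X U} = AB_sets X \<longleftrightarrow> (\<forall>A\<in>AB_sets X. openin X A))"
  \<comment> \<open>Open sets are always \<A>\<B>-sets, so equality of the two families reduces to
    the inclusion saying that \<A>\<B>-sets are open.\<close>
  using openin_imp_AB_sets[of X]
  unfolding extremally_disconnected_space_iff_AB_sets_openin by blast

end
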